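(* The hypergraph $\mathsf H_{20}$ (defined in the context) has no faithful orthogonal representation in $\mathbb R^3$.
   Context: Inner product: $\langle x,y\rangle=\sum_{k}\overline{x_k}\,y_k$ (over $\mathbb R$, the standard dot product). Faithful orthogonal representation: let $\mathsf H=(V,\mathcal E)$ be a three-uniform hypergraph, $\mathbb F\in\{\mathbb R,\mathbb C\}$ and $d\ge 3$. A faithful orthogonal representation of $\mathsf H$ in $\mathbb F^d$ assigns to every $v\in V$ a nonzero vector $x_v\in\mathbb F^d$ such that (1) distinct vertices determine distinct rays (one-dimensional subspaces), and (2) for distinct $u,v\in V$, $\langle x_u,x_v\rangle=0$ if and only if $u$ and $v$ belong to a common hyperedge. The hypergraph $\mathsf H_{20}$: it has 20 vertices, namely $v_0,\ldots,v_7$ (midpoints), $v_{01},v_{12},v_{23},v_{34},v_{45},v_{56},v_{67},v_{70}$ (corners; also written $v_{j,j+1}$ with indices modulo $8$), and $a_1,a_2,b_1,b_2$. It has 12 hyperedges: $E_j=\{v_{j-1,j},\,v_j,\,v_{j,j+1}\}$ for $j=0,\ldots,7$ (indices modulo $8$), and $D_0=\{v_0,a_1,v_4\}$, $D_2=\{v_2,a_2,v_6\}$, $D_1=\{v_1,b_2,v_5\}$, $D_3=\{v_3,b_1,v_7\}$. *)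

theory Defs
  imports "HOL-Analysis.Analysis"
begin

definition three_uniform_hypergraph :: "'v set \<Rightarrow> 'v set set \<Rightarrow> bool" where
  "three_uniform_hypergraph V \<E> \<longleftrightarrow> (\<forall>e\<in>\<E>. e \<subseteq> V \<and> card e = 3)"

text \<open>
  Over the reals the sesquilinear product is the dot product of \<open>real ^ 'd\<close>; the ray
  determined by a nonzero vector is its one-dimensional span.
\<close>

definition faithful_orthogonal_representation ::
    "'v set \<Rightarrow> 'v set set \<Rightarrow> ('v \<Rightarrow> real ^ 'd) \<Rightarrow> bool" where
  "faithful_orthogonal_representation V \<E> x \<longleftrightarrow>
     (\<forall>v\<in>V. x v \<noteq> 0) \<and>
     (\<forall>u\<in>V. \<forall>v\<in>V. u \<noteq> v \<longrightarrow> span {x u} \<noteq> span {x v}) \<and>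
     (\<forall>u\<in>V. \<forall>v\<in>V. u \<noteq> v \<longrightarrow> (x u \<bullet> x v = 0 \<longleftrightarrow> (\<exists>e\<in>\<E>. u \<in> e \<and> v \<in> e)))"

text \<open>
  \<open>Mid j\<close> is the midpoint \<open>v\<^sub>j\<close>, and \<open>Corner j\<close> is the corner \<open>v\<^bsub>j,j+1\<^esub>\<close>
  (indices modulo 8); only indices below 8 occur in the hypergraph.
\<close>

datatype h20_vertex = Mid nat | Corner nat | A1 | A2 | B1 | B2

definition H20_vertices :: "h20_vertex set" where
  "H20_vertices = Mid ` {..<8} \<union> Corner ` {..<8} \<union> {A1, A2, B1, B2}"

text \<open>The index \<open>(j + 7) mod 8\<close> is \<open>j - 1\<close> modulo 8.\<close>

definition H20_cycle_edge :: "nat \<Rightarrow> h20_vertex set" where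
  "H20_cycle_edge j = {Corner ((j + 7) mod 8), Mid j, Corner j}"

definition H20_edges :: "h20_vertex set set" where
  "H20_edges = H20_cycle_edge ` {..<8} \<union>
     {{Mid 0, A1, Mid 4}, {Mid 2, A2, Mid 6}, {Mid 1, B2, Mid 5}, {Mid 3, B1, Mid 7}}"

lemma card_H20_vertices: "card H20_vertices = 20"
  by (simp add: H20_vertices_def lessThan_nat_numeral lessThan_Suc)

lemma card_H20_edges: "card H20_edges = 12"
proof -
  let ?D = "{{Mid 0, A1, Mid 4}, {Mid 2, A2, Mid 6}, {Mid 1, B2, Mid 5}, {Mid 3, B1, Mid 7}}"
  have "inj_on H20_cycle_edge {..<8}"
    unfolding inj_on_def H20_cycle_edge_def by blast
  then have "card (H20_cycle_edge ` {..<8}) = 8"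
    by (simp add: card_image)
  moreover have "{Mid 0, A1, Mid 4} \<noteq> {Mid 2, A2, Mid 6}" "{Mid 0, A1, Mid 4} \<noteq> {Mid 1, B2, Mid 5}"
    "{Mid 0, A1, Mid 4} \<noteq> {Mid 3, B1, Mid 7}" "{Mid 2, A2, Mid 6} \<noteq> {Mid 1, B2, Mid 5}"
    "{Mid 2, A2, Mid 6} \<noteq> {Mid 3, B1, Mid 7}" "{Mid 1, B2, Mid 5} \<noteq> {Mid 3, B1, Mid 7}"
    by blast+
  then have "card ?D = 4"
    by (simp only: card_insert_if finite.intros insert_iff empty_iff) simp
  moreover have "H20_cycle_edge ` {..<8} \<inter> ?D = {}"
    unfolding H20_cycle_edge_def by blast
  ultimately show ?thesis
    by (simp add: H20_edges_def card_Un_disjoint del: Un_insert_right)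
qed

lemma three_uniform_H20: "three_uniform_hypergraph H20_vertices H20_edges"
  by (simp add: three_uniform_hypergraph_def H20_vertices_def H20_edges_def
      H20_cycle_edge_def lessThan_nat_numeral lessThan_Suc)

end

theory Submission
  imports Defs
begin

text \<open>
  Let \<open>a, b, c, d\<close> be unit vectors on the rays of the corners \<open>v\<^sub>1\<^sub>2, v\<^sub>3\<^sub>4, v\<^sub>5\<^sub>6, v\<^sub>7\<^sub>0\<close>. In
  dimension 3 each of the other corners is orthogonal to two of them that are cyclic neighbours,
  so each midpoint is, up to scale, the projection of one of these vectors off a neighbour, and
  \<open>D\<^sub>1, D\<^sub>2, D\<^sub>3\<close> become three equations between the products \<open>p = a\<bullet>b\<close>, \<open>q = b\<bullet>c\<close>, \<open>r = c\<bullet>d\<close>, \<open>s = d\<bullet>a\<close>, \<open>x = a\<bullet>c\<close>,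
  \<open>y = b\<bullet>d\<close>. Since \<open>x \<noteq> 0\<close> they give \<open>p r = q s\<close>, and together with the vanishing of the Gram determinant of
  four vectors in dimension 3 they force \<open>p r = x y\<close>. Then \<open>p\<^sup>2 + r\<^sup>2\<close> and \<open>q\<^sup>2 + s\<^sup>2\<close> have the same
  sum and product as \<open>x\<^sup>2 + y\<^sup>2\<close> and \<open>1 + x\<^sup>2 y\<^sup>2\<close>, so that \<open>(1 - p\<^sup>2) (1 - r\<^sup>2) = 0\<close> or
  \<open>(1 - q\<^sup>2) (1 - s\<^sup>2) = 0\<close>, and two corners span the same ray.
\<close>

lemma orthogonal_to_three_eq_0:
  fixes u v w z :: "real ^ 3"
  assumes "u \<noteq> 0" "v \<noteq> 0" "w \<noteq> 0"
    and "u \<bullet> v = 0" "u \<bullet> w = 0" "v \<bullet> w = 0"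
    and "z \<bullet> u = 0" "z \<bullet> v = 0" "z \<bullet> w = 0"
  shows "z = 0"
proof (rule ccontr)
  assume "z \<noteq> 0"
  have distinct: "u \<noteq> v" "u \<noteq> w" "v \<noteq> w" "z \<noteq> u" "z \<noteq> v" "z \<noteq> w"
    using assms \<open>z \<noteq> 0\<close> by auto
  have "pairwise orthogonal {u, v, w, z}"
    using assms by (auto simp: pairwise_def orthogonal_def inner_commute)
  then have "independent {u, v, w, z}"
    using assms \<open>z \<noteq> 0\<close> by (intro pairwise_orthogonal_independent) auto
  then have "card {u, v, w, z} \<le> 3"
    using independent_bound[of "{u, v, w, z}"] by simp
  then show False
    using distinct by auto
qed

text \<open>Here \<open>u\<close>, \<open>a\<close>, \<open>m\<close> form an orthogonal basis, and
  \<open>d\<close> has no component along \<open>u\<close>; removing the one along \<open>a\<close>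
  leaves only the one along \<open>m\<close>.\<close>

lemma projection_parallel:
  fixes a d m u :: "real ^ 3"
  assumes "norm a = 1" "u \<noteq> 0" "m \<noteq> 0"
    and "u \<bullet> a = 0" "u \<bullet> d = 0" "u \<bullet> m = 0" "a \<bullet> m = 0"
  shows "\<exists>k. d - (a \<bullet> d) *\<^sub>R a = k *\<^sub>R m"
proof -
  let ?w = "d - (a \<bullet> d) *\<^sub>R a"
  have "a \<noteq> 0" "a \<bullet> a = 1"
    using assms(1) by (auto simp: dot_square_norm)
  have "?w - (?w \<bullet> m / (m \<bullet> m)) *\<^sub>R m = 0"
    by (rule orthogonal_to_three_eq_0[of u a m])
      (use assms \<open>a \<noteq> 0\<close> \<open>a \<bullet> a = 1\<close> in
        \<open>auto simp: inner_diff_left inner_diff_right inner_commute\<close>)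
  then show ?thesis by auto
qed

text \<open>The left-hand side is the Gram determinant. A linear dependency between four vectors in
  dimension 3 gives a nonzero kernel vector of the Gram matrix.\<close>

lemma gram_det_4_eq_0:
  fixes a b c d :: "real ^ 3"
  assumes "norm a = 1" "norm b = 1" "norm c = 1" "norm d = 1"
  defines "p \<equiv> a \<bullet> b" and "q \<equiv> b \<bullet> c" and "r \<equiv> c \<bullet> d" and "s \<equiv> d \<bullet> a"
    and "x \<equiv> a \<bullet> c" and "y \<equiv> b \<bullet> d"
  shows "1 - (p\<^sup>2 + q\<^sup>2 + r\<^sup>2 + s\<^sup>2 + x\<^sup>2 + y\<^sup>2) + 2 * (p * q * x + q * r * y + r * s * x + s * p * y)
    + p\<^sup>2 * r\<^sup>2 + q\<^sup>2 * s\<^sup>2 + x\<^sup>2 * y\<^sup>2 - 2 * (p * q * r * s + p * r * x * y + q * s * x * y) = 0"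
    (is "?g = 0")
proof -
  obtain \<alpha> \<beta> \<gamma> \<delta> where nz: "\<alpha> \<noteq> 0 \<or> \<beta> \<noteq> 0 \<or> \<gamma> \<noteq> 0 \<or> \<delta> \<noteq> 0"
    and dep: "\<alpha> *\<^sub>R a + \<beta> *\<^sub>R b + \<gamma> *\<^sub>R c + \<delta> *\<^sub>R d = 0"
  proof -
    let ?f = "\<lambda>v :: real ^ 4. v $ 1 *\<^sub>R a + v $ 2 *\<^sub>R b + v $ 3 *\<^sub>R c + v $ 4 *\<^sub>R d"
    have lin: "linear ?f"
      by (rule linearI) (simp_all add: algebra_simps)
    have "\<not> inj ?f"
    proof
      assume "inj ?f"
      then have "dim (range ?f) = 4"
        using dim_image_eq[OF lin, of UNIV] by simp
      then show False
        using dim_subset_UNIV[of "range ?f"] by simp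
    qed
    then obtain v where "?f v = 0" "v \<noteq> 0"
      using linear_injective_0[OF lin] by auto
    moreover from \<open>v \<noteq> 0\<close> have "v $ 1 \<noteq> 0 \<or> v $ 2 \<noteq> 0 \<or> v $ 3 \<noteq> 0 \<or> v $ 4 \<noteq> 0"
      by (auto simp: vec_eq_iff forall_4)
    ultimately show thesis by (rule_tac that)
  qed
  have unit: "a \<bullet> a = 1" "b \<bullet> b = 1" "c \<bullet> c = 1" "d \<bullet> d = 1"
    using assms(1-4) by (auto simp: dot_square_norm)
  have "\<alpha> + p * \<beta> + x * \<gamma> + s * \<delta> = 0"
    using arg_cong[OF dep, of "\<lambda>v. a \<bullet> v"] unit
    by (simp add: inner_add_right p_def s_def x_def inner_commute mult.commute)
  moreover have "p * \<alpha> + \<beta> + q * \<gamma> + y * \<delta> = 0"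
    using arg_cong[OF dep, of "\<lambda>v. b \<bullet> v"] unit
    by (simp add: inner_add_right p_def q_def y_def inner_commute mult.commute)
  moreover have "x * \<alpha> + q * \<beta> + \<gamma> + r * \<delta> = 0"
    using arg_cong[OF dep, of "\<lambda>v. c \<bullet> v"] unit
    by (simp add: inner_add_right r_def q_def x_def inner_commute mult.commute)
  moreover have "s * \<alpha> + y * \<beta> + r * \<gamma> + \<delta> = 0"
    using arg_cong[OF dep, of "\<lambda>v. d \<bullet> v"] unit
    by (simp add: inner_add_right r_def s_def y_def inner_commute mult.commute)
  \<comment> \<open>Cramer's rule: apply the adjugate of the Gram matrix to the system.\<close>
  ultimately have "?g * \<alpha> = 0" "?g * \<beta> = 0" "?g * \<gamma> = 0" "?g * \<delta> = 0"
    by algebra+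
  then show ?thesis using nz by auto
qed

lemma no_real_gram_solution:
  fixes p q r s x y :: real
  assumes eqs: "y - q * r - s * p + s * q * x = 0" "y - q * r - s * p + p * r * x = 0"
      "x - r * s - p * q + p * r * y = 0"
    and gram: "1 - (p\<^sup>2 + q\<^sup>2 + r\<^sup>2 + s\<^sup>2 + x\<^sup>2 + y\<^sup>2)
      + 2 * (p * q * x + q * r * y + r * s * x + s * p * y)
      + p\<^sup>2 * r\<^sup>2 + q\<^sup>2 * s\<^sup>2 + x\<^sup>2 * y\<^sup>2 - 2 * (p * q * r * s + p * r * x * y + q * s * x * y) = 0"
    and nz: "p \<noteq> 0" "r \<noteq> 0" "x \<noteq> 0"
    and bounds: "\<bar>p\<bar> < 1" "\<bar>q\<bar> < 1" "\<bar>r\<bar> < 1" "\<bar>s\<bar> < 1" "\<bar>x\<bar> \<le> 1" "\<bar>y\<bar> \<le> 1"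
  shows False
proof -
  have "x * (s * q - p * r) = 0"
    using eqs by algebra
  with nz have sq: "s * q = p * r" by simp
  \<comment> \<open>By \<open>sq\<close> the terms in \<open>gram\<close> without \<open>x\<close>
    and \<open>y\<close> of degree four cancel; the last two of \<open>eqs\<close> rewrite
    \<open>q * r + s * p\<close> and \<open>r * s + p * q\<close>.\<close>
  have sum: "p\<^sup>2 + q\<^sup>2 + r\<^sup>2 + s\<^sup>2 = (1 + x\<^sup>2) * (1 + y\<^sup>2)"
    using gram eqs sq by algebra
  \<comment> \<open>By \<open>sq\<close>, the right-hand product expands to \<open>p * r\<close>
    times the sum of the four squares.\<close>
  have "p * r * ((1 + x\<^sup>2) * (1 + y\<^sup>2)) = (q * r + s * p) * (r * s + p * q)"
    using sum sq by algebra
  also have "\<dots> = (y + p * r * x) * (x + p * r * y)"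
    using eqs by algebra
  finally have "(p * r - x * y) * (1 - p * r * (x * y)) = 0"
    by algebra
  moreover have "\<bar>p * r * (x * y)\<bar> < 1"
  proof -
    have "\<bar>p\<bar> * \<bar>r\<bar> < 1 * 1"
      using bounds by (intro mult_strict_mono) auto
    moreover have "\<bar>x\<bar> * \<bar>y\<bar> \<le> 1 * 1"
      using bounds by (intro mult_mono) auto
    moreover have "(\<bar>p\<bar> * \<bar>r\<bar>) * (\<bar>x\<bar> * \<bar>y\<bar>) \<le> (\<bar>p\<bar> * \<bar>r\<bar>) * 1"
      using calculation by (intro mult_left_mono) auto
    ultimately show ?thesis by (simp add: abs_mult)
  qed
  ultimately have pr: "p * r = x * y" by auto
  have "(p\<^sup>2 + r\<^sup>2) * (q\<^sup>2 + s\<^sup>2) = (q * r + s * p)\<^sup>2 + (r * s + p * q)\<^sup>2 - 4 * (x * y)\<^sup>2"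
    using pr sq by algebra
  also have "\<dots> = (x\<^sup>2 + y\<^sup>2) * (1 + x\<^sup>2 * y\<^sup>2)"
    using eqs pr by algebra
  \<comment> \<open>Put \<open>T = 1 + x\<^sup>2 * y\<^sup>2\<close>. By \<open>pr\<close> and
    \<open>sq\<close> the two factors are \<open>T - (p\<^sup>2 + r\<^sup>2)\<close> and
    \<open>T - (q\<^sup>2 + s\<^sup>2)\<close>, and \<open>T\<close> equals one of the two
    sums.\<close>
  finally have "((1 - p\<^sup>2) * (1 - r\<^sup>2)) * ((1 - q\<^sup>2) * (1 - s\<^sup>2)) = 0"
    using sum pr sq by algebra
  moreover have "p\<^sup>2 < 1" "q\<^sup>2 < 1" "r\<^sup>2 < 1" "s\<^sup>2 < 1"
    using bounds by (auto simp: abs_square_less_1)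
  ultimately show False by auto
qed

lemma abs_inner_less_1:
  fixes u v :: "'a::real_inner"
  assumes "norm u = 1" "norm v = 1" "span {u} \<noteq> span {v}"
  shows "\<bar>u \<bullet> v\<bar> < 1"
proof (rule ccontr)
  assume "\<not> ?thesis"
  with assms have "\<bar>u \<bullet> v\<bar> = norm u * norm v"
    using Cauchy_Schwarz_ineq2[of u v] by simp
  then have "v = u \<or> v = - u"
    using assms unfolding norm_cauchy_schwarz_abs_eq by simp
  then have "u \<in> span {v}" "v \<in> span {u}"
    using span_neg[OF span_base, of "- u" "{- u}"] by (auto simp: span_base span_neg)
  then have "span {u} = span {v}"
    by (intro subset_antisym span_minimal) auto
  then show False
    using assms(3) by simp
qed

text \<open>All conditions depend only on the rays, so unit vectors may be assumed.\<close>

lemma faithful_orthogonal_representation_sgn: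
  assumes "faithful_orthogonal_representation V \<E> x"
  shows "faithful_orthogonal_representation V \<E> (\<lambda>v. sgn (x v))"
proof -
  have "span {sgn (x v)} = span {x v}" if "x v \<noteq> 0" for v
  proof -
    have "x v = norm (x v) *\<^sub>R sgn (x v)" "sgn (x v) = inverse (norm (x v)) *\<^sub>R x v"
      using that by (auto simp: sgn_div_norm)
    then have "x v \<in> span {sgn (x v)}" "sgn (x v) \<in> span {x v}"
      by (metis span_base span_scale singletonI)+
    then show ?thesis
      by (intro subset_antisym span_minimal) auto
  qed
  with assms show ?thesis
    by (auto simp: faithful_orthogonal_representation_def sgn_zero_iff sgn_div_norm)
qed

theorem theorem5:
  "\<not> (\<exists>x :: h20_vertex \<Rightarrow> real ^ 3.
        faithful_orthogonal_representation H20_vertices H20_edges x)"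
proof
  assume "\<exists>x :: h20_vertex \<Rightarrow> real ^ 3.
    faithful_orthogonal_representation H20_vertices H20_edges x"
  then obtain x :: "h20_vertex \<Rightarrow> real ^ 3"
    where x: "faithful_orthogonal_representation H20_vertices H20_edges x" ..
  define f where "f v = sgn (x v)" for v
  have f: "faithful_orthogonal_representation H20_vertices H20_edges f"
    using faithful_orthogonal_representation_sgn[OF x] by (simp add: f_def[abs_def])
  define M where "M j = f (Mid j)" for j
  define C where "C j = f (Corner j)" for j
  have nz: "M j \<noteq> 0" "C j \<noteq> 0" if "j < 8" for j
    using f that by (auto simp: faithful_orthogonal_representation_def H20_vertices_def M_def C_def)
  have unit: "norm (C j) = 1" if "j < 8" for j
    using nz(2)[OF that] by (simp add: C_def f_def norm_sgn sgn_zero_iff)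
  have rays: "span {C i} \<noteq> span {C j}" if "i < 8" "j < 8" "i \<noteq> j" for i j
    using f that by (auto simp: faithful_orthogonal_representation_def H20_vertices_def C_def)
  have orth: "f u \<bullet> f v = 0"
    if "e \<in> H20_edges" "u \<in> e" "v \<in> e" "u \<noteq> v" for e u v
  proof -
    have "u \<in> H20_vertices" "v \<in> H20_vertices"
      using that three_uniform_H20 by (auto simp: three_uniform_hypergraph_def)
    then show ?thesis
      using f that by (auto simp: faithful_orthogonal_representation_def)
  qed
  have CC: "C ((j + 7) mod 8) \<bullet> C j = 0" and MC: "C ((j + 7) mod 8) \<bullet> M j = 0" "C j \<bullet> M j = 0"
    if "j < 8" for j
  proof -
    have e: "H20_cycle_edge j \<in> H20_edges"
      using that by (auto simp: H20_edges_def)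
    have "(j + 7) mod 8 \<noteq> j" using that by presburger
    then show "C ((j + 7) mod 8) \<bullet> C j = 0" "C ((j + 7) mod 8) \<bullet> M j = 0" "C j \<bullet> M j = 0"
      unfolding C_def M_def by (auto intro!: orth[OF e] simp: H20_cycle_edge_def)
  qed
  note CC' = CC[of 0] CC[of 1] CC[of 2] CC[of 3] CC[of 4] CC[of 5] CC[of 6] CC[of 7]
  note MC' = MC[of 0] MC[of 1] MC[of 2] MC[of 3] MC[of 4] MC[of 5] MC[of 6] MC[of 7]
  have MM: "M 2 \<bullet> M 6 = 0" "M 1 \<bullet> M 5 = 0" "M 3 \<bullet> M 7 = 0"
    unfolding M_def
    by (rule orth[of "{Mid 2, A2, Mid 6}"]
        orth[of "{Mid 1, B2, Mid 5}"] orth[of "{Mid 3, B1, Mid 7}"]; simp add: H20_edges_def)+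
  \<comment> \<open>These pairs yield the nonzero products \<open>p\<close>, \<open>r\<close> and
    \<open>x\<close>.\<close>
  have nonorth: "C i \<bullet> C j \<noteq> 0" if "(i, j) \<in> {(1, 3), (5, 7), (1, 5)}" for i j
  proof -
    have "\<not> (\<exists>e\<in>H20_edges. Corner i \<in> e \<and> Corner j \<in> e)"
      using that by (auto simp: H20_edges_def H20_cycle_edge_def lessThan_nat_numeral lessThan_Suc)
    moreover have "Corner i \<in> H20_vertices" "Corner j \<in> H20_vertices" "i \<noteq> j"
      using that by (auto simp: H20_vertices_def)
    ultimately show ?thesis
      using f by (auto simp: faithful_orthogonal_representation_def C_def)
  qed
  let ?parallel = "\<lambda>i k m. \<exists>t. C i - (C k \<bullet> C i) *\<^sub>R C k = t *\<^sub>R M m"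
  \<comment> \<open>In each case \<open>u\<close> is the even corner between \<open>C i\<close> and
    \<open>C k\<close>, and \<open>M m\<close> is the midpoint between \<open>u\<close> and
    \<open>C k\<close>.\<close>
  have par: "?parallel 7 1 1" "?parallel 3 1 2" "?parallel 1 3 3"
      "?parallel 3 5 5" "?parallel 7 5 6" "?parallel 5 7 7"
    by (rule projection_parallel[where u = "C 0"] projection_parallel[where u = "C 2"]
        projection_parallel[where u = "C 4"] projection_parallel[where u = "C 6"];
        use CC' MC' in \<open>simp add: unit nz inner_commute\<close>)+
  have orth_par: "(C i - (C k \<bullet> C i) *\<^sub>R C k) \<bullet> (C j - (C l \<bullet> C j) *\<^sub>R C l) = 0"
    if "?parallel i k m" "?parallel j l n" "M m \<bullet> M n = 0" for i j k l m n
    using that by auto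
  show False
  \<comment> \<open>\<open>C 1\<close>, \<open>C 3\<close>, \<open>C 5\<close>, \<open>C 7\<close>
    serve as \<open>a\<close>, \<open>b\<close>, \<open>c\<close>, \<open>d\<close>; the equations
    come from \<open>D\<^sub>1\<close>, \<open>D\<^sub>2\<close>, \<open>D\<^sub>3\<close> in this
    order.\<close>
  proof (rule no_real_gram_solution)
    show "C 3 \<bullet> C 7 - C 3 \<bullet> C 5 * (C 5 \<bullet> C 7) - C 7 \<bullet> C 1 * (C 1 \<bullet> C 3)
        + C 7 \<bullet> C 1 * (C 3 \<bullet> C 5) * (C 1 \<bullet> C 5) = 0"
      using orth_par[OF par(1,4) MM(2)]
      by (simp add: inner_diff_left inner_diff_right inner_commute algebra_simps)
    show "C 3 \<bullet> C 7 - C 3 \<bullet> C 5 * (C 5 \<bullet> C 7) - C 7 \<bullet> C 1 * (C 1 \<bullet> C 3)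
        + C 1 \<bullet> C 3 * (C 5 \<bullet> C 7) * (C 1 \<bullet> C 5) = 0"
      using orth_par[OF par(2,5) MM(1)]
      by (simp add: inner_diff_left inner_diff_right inner_commute algebra_simps)
    show "C 1 \<bullet> C 5 - C 5 \<bullet> C 7 * (C 7 \<bullet> C 1) - C 1 \<bullet> C 3 * (C 3 \<bullet> C 5)
        + C 1 \<bullet> C 3 * (C 5 \<bullet> C 7) * (C 3 \<bullet> C 7) = 0"
      using orth_par[OF par(3,6) MM(3)]
      by (simp add: inner_diff_left inner_diff_right inner_commute algebra_simps)
  qed (use gram_det_4_eq_0[of "C 1" "C 3" "C 5" "C 7"] nonorth
      in \<open>simp_all add: unit rays abs_inner_less_1 less_imp_le\<close>)
qed

end
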